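(* Let $(M,g)$ be a Riemannian manifold of real dimension at least $4$, and let $\nabla$ be the Levi-Civita connection of $g$. If $g$ has non-zero constant sectional curvature, then $M$ does not admit a complex structure $A\in C(M)$ satisfying $d^{\nabla}A=0$.
   Context: $T_M$ is the tangent bundle and $\Omega^k(M,T_M)$ is the space of $T_M$-valued differential $k$-forms; an element of $\Omega^1(M,T_M)$ is the same as a smooth field of endomorphisms of $T_M$. $AC(M)=\{A\in\Omega^1(M,T_M)\mid A\circ A=-\mathrm{Id}\}$ is the set of almost-complex structures on $M$. The Nijenhuis tensor of $A\in AC(M)$ is $N_A(\zeta,\eta)=[A(\zeta),A(\eta)]-A([A(\zeta),\eta]+[\zeta,A(\eta)])-[\zeta,\eta]$ for vector fields $\zeta,\eta$, and $C(M)=\{A\in AC(M)\mid N_A=0\}$ is the set of complex (integrable almost-complex) structures. The covariant exterior derivative $d^\nabla:\Omega^k(M,T_M)\to\Omega^{k+1}(M,T_M)$ is $(d^\nabla\alpha)(\zeta_0,\dots,\zeta_k)=\sum_{i=0}^k(-1)^i(\nabla_{\zeta_i}\alpha)(\zeta_0,\dots,\widehat{\zeta_i},\dots,\zeta_k)$; in particular $d^\nabla A(\zeta,\eta)=(\nabla_\zeta A)(\eta)-(\nabla_\eta A)(\zeta)$. Curvature: $R^\nabla(X,Y)Z=\nabla_X\nabla_YZ-\nabla_Y\nabla_XZ-\nabla_{[X,Y]}Z$, $Rm(X,Y,Z,W)=g(R^\nabla(X,Y)Z,W)$. The sectional curvature of a $2$-plane $\Pi_p\subset T_{M,p}$ with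 basis $(X,Y)$ is $K(\Pi_p)=\frac{Rm(X,Y,X,Y)}{g(X,X)g(Y,Y)-g(X,Y)^2}$ (an overall sign convention, immaterial here). $(M,g)$ has constant sectional curvature $c_0$ if $K(\Pi_p)=c_0$ for all $p\in M$ and all $2$-planes $\Pi_p\subset T_{M,p}$. *)

theory Defs
  imports "HOL-Analysis.Analysis" "HOL-Library.Function_Algebras"
begin

section \<open>Smooth manifolds\<close>

text \<open>
  \<open>k\<close>-fold continuous differentiability, for \<open>S\<close> open: all iterated directional derivatives
  up to order \<open>k\<close> exist and are continuous.
\<close>

primrec Ck_on :: "nat \<Rightarrow> 'e set \<Rightarrow> ('e::euclidean_space \<Rightarrow> 'f::euclidean_space) \<Rightarrow> bool" where
  "Ck_on 0 S f \<longleftrightarrow> continuous_on S f"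
| "Ck_on (Suc k) S f \<longleftrightarrow>
     (\<forall>x\<in>S. f differentiable (at x)) \<and> (\<forall>v. Ck_on k S (\<lambda>x. frechet_derivative f (at x) v))"

definition smooth_on :: "'e set \<Rightarrow> ('e::euclidean_space \<Rightarrow> 'f::euclidean_space) \<Rightarrow> bool" where
  "smooth_on S f \<longleftrightarrow> (\<forall>k. Ck_on k S f)"

type_synonym ('a, 'e) atlas = "('a set \<times> ('a \<Rightarrow> 'e)) set"

text \<open>
  A nonempty smooth manifold without boundary, of dimension \<open>DIM('e)\<close>. The atlas need not be
  maximal: every notion below depends only on the smooth structure that it generates.
\<close>

definition smooth_manifold :: "'a topology \<Rightarrow> ('a, 'e::euclidean_space) atlas \<Rightarrow> bool" where
  "smooth_manifold T \<A> \<longleftrightarrow>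
     topspace T \<noteq> {} \<and> Hausdorff_space T \<and> second_countable T \<and>
     (\<Union>(U, \<phi>)\<in>\<A>. U) = topspace T \<and>
     (\<forall>(U, \<phi>)\<in>\<A>. openin T U \<and> open (\<phi> ` U) \<and>
        homeomorphic_map (subtopology T U) (top_of_set (\<phi> ` U)) \<phi>) \<and>
     (\<forall>(U, \<phi>)\<in>\<A>. \<forall>(V, \<psi>)\<in>\<A>. smooth_on (\<phi> ` (U \<inter> V)) (\<psi> \<circ> inv_into U \<phi>))"

definition points :: "('a, 'e) atlas \<Rightarrow> 'a set" where
  "points \<A> = (\<Union>(U, \<phi>)\<in>\<A>. U)"

text \<open>
  Throughout, objects living on the manifold are extended by zero to points outside of it, so
  that equality of HOL functions is equality on the manifold. The operations \<open>+\<close>, \<open>-\<close>, \<open>0\<close> (and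
  \<open>*\<close> for real-valued functions) on function types are the pointwise ones.
\<close>

definition smooth_funs :: "('a, 'e::euclidean_space) atlas \<Rightarrow> ('a \<Rightarrow> real) set" where
  "smooth_funs \<A> = {f. (\<forall>(U, \<phi>)\<in>\<A>. smooth_on (\<phi> ` U) (f \<circ> inv_into U \<phi>)) \<and>
                       (\<forall>p. p \<notin> points \<A> \<longrightarrow> f p = 0)}"


section \<open>Tangent vectors and vector fields\<close>

type_synonym 'a tvec = "('a \<Rightarrow> real) \<Rightarrow> real"
type_synonym 'a vfield = "'a \<Rightarrow> 'a tvec"

definition scale_vec :: "real \<Rightarrow> 'a tvec \<Rightarrow> 'a tvec" where
  "scale_vec a v = (\<lambda>f. a * v f)"

definition scale_field :: "('a \<Rightarrow> real) \<Rightarrow> 'a vfield \<Rightarrow> 'a vfield" where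
  "scale_field f X = (\<lambda>p. scale_vec (f p) (X p))"

text \<open>
  Tangent vectors at \<open>p\<close> are the derivations at \<open>p\<close> of the algebra of smooth functions, with
  value 0 by convention on functions that are not smooth.
\<close>

definition tangent_space :: "('a, 'e::euclidean_space) atlas \<Rightarrow> 'a \<Rightarrow> 'a tvec set" where
  "tangent_space \<A> p = {v.
     (\<forall>f\<in>smooth_funs \<A>. \<forall>h\<in>smooth_funs \<A>. v (f + h) = v f + v h) \<and>
     (\<forall>a. \<forall>f\<in>smooth_funs \<A>. v (\<lambda>q. a * f q) = a * v f) \<and>
     (\<forall>f\<in>smooth_funs \<A>. \<forall>h\<in>smooth_funs \<A>. v (f * h) = f p * v h + h p * v f) \<and>
     (\<forall>f. f \<notin> smooth_funs \<A> \<longrightarrow> v f = 0)}"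

definition deriv_along :: "'a vfield \<Rightarrow> ('a \<Rightarrow> real) \<Rightarrow> 'a \<Rightarrow> real" where
  "deriv_along X f = (\<lambda>p. X p f)"

definition vector_fields :: "('a, 'e::euclidean_space) atlas \<Rightarrow> 'a vfield set" where
  "vector_fields \<A> = {X.
     (\<forall>p\<in>points \<A>. X p \<in> tangent_space \<A> p) \<and>
     (\<forall>p. p \<notin> points \<A> \<longrightarrow> X p = 0) \<and>
     (\<forall>f\<in>smooth_funs \<A>. deriv_along X f \<in> smooth_funs \<A>)}"

definition lie_bracket :: "'a vfield \<Rightarrow> 'a vfield \<Rightarrow> 'a vfield" where
  "lie_bracket X Y = (\<lambda>p f. X p (deriv_along Y f) - Y p (deriv_along X f))"


section \<open>Riemannian metrics, the Levi-Civita connection and curvature\<close>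

type_synonym 'a metric_tensor = "'a \<Rightarrow> 'a tvec \<Rightarrow> 'a tvec \<Rightarrow> real"
type_synonym 'a conn = "'a vfield \<Rightarrow> 'a vfield \<Rightarrow> 'a vfield"

definition inner_fields :: "'a metric_tensor \<Rightarrow> 'a vfield \<Rightarrow> 'a vfield \<Rightarrow> 'a \<Rightarrow> real" where
  "inner_fields g X Y = (\<lambda>p. g p (X p) (Y p))"

definition riemannian_metric :: "('a, 'e::euclidean_space) atlas \<Rightarrow> 'a metric_tensor \<Rightarrow> bool" where
  "riemannian_metric \<A> g \<longleftrightarrow>
     (\<forall>p\<in>points \<A>. \<forall>u\<in>tangent_space \<A> p. \<forall>v\<in>tangent_space \<A> p.
        g p u v = g p v u \<and>
        (\<forall>w\<in>tangent_space \<A> p. g p (u + v) w = g p u w + g p v w) \<and>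
        (\<forall>a. g p (scale_vec a u) v = a * g p u v) \<and>
        (u \<noteq> 0 \<longrightarrow> g p u u > 0)) \<and>
     (\<forall>p. p \<notin> points \<A> \<longrightarrow> (\<forall>u v. g p u v = 0)) \<and>
     (\<forall>X\<in>vector_fields \<A>. \<forall>Y\<in>vector_fields \<A>. inner_fields g X Y \<in> smooth_funs \<A>)"

definition connection :: "('a, 'e::euclidean_space) atlas \<Rightarrow> 'a conn \<Rightarrow> bool" where
  "connection \<A> nabla \<longleftrightarrow>
     (\<forall>X\<in>vector_fields \<A>. \<forall>Y\<in>vector_fields \<A>.
        nabla X Y \<in> vector_fields \<A> \<and>
        (\<forall>Z\<in>vector_fields \<A>. nabla (X + Y) Z = nabla X Z + nabla Y Z \<and>
                              nabla X (Y + Z) = nabla X Y + nabla X Z) \<and>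
        (\<forall>f\<in>smooth_funs \<A>.
           nabla (scale_field f X) Y = scale_field f (nabla X Y) \<and>
           nabla X (scale_field f Y) = scale_field (deriv_along X f) Y + scale_field f (nabla X Y)))"

definition levi_civita ::
  "('a, 'e::euclidean_space) atlas \<Rightarrow> 'a metric_tensor \<Rightarrow> 'a conn \<Rightarrow> bool" where
  "levi_civita \<A> g nabla \<longleftrightarrow>
     connection \<A> nabla \<and>
     (\<forall>X\<in>vector_fields \<A>. \<forall>Y\<in>vector_fields \<A>. nabla X Y - nabla Y X = lie_bracket X Y) \<and>
     (\<forall>X\<in>vector_fields \<A>. \<forall>Y\<in>vector_fields \<A>. \<forall>Z\<in>vector_fields \<A>.
        deriv_along X (inner_fields g Y Z) =
          inner_fields g (nabla X Y) Z + inner_fields g Y (nabla X Z))"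

definition curvature :: "'a conn \<Rightarrow> 'a vfield \<Rightarrow> 'a vfield \<Rightarrow> 'a vfield \<Rightarrow> 'a vfield" where
  "curvature nabla X Y Z =
     nabla X (nabla Y Z) - nabla Y (nabla X Z) - nabla (lie_bracket X Y) Z"

definition riemann_tensor :: "'a metric_tensor \<Rightarrow> 'a conn \<Rightarrow>
    'a vfield \<Rightarrow> 'a vfield \<Rightarrow> 'a vfield \<Rightarrow> 'a vfield \<Rightarrow> 'a \<Rightarrow> real" where
  "riemann_tensor g nabla X Y Z W = inner_fields g (curvature nabla X Y Z) W"

definition lin_indep2 :: "'a tvec \<Rightarrow> 'a tvec \<Rightarrow> bool" where
  "lin_indep2 u v \<longleftrightarrow> (\<forall>a b. scale_vec a u + scale_vec b v = 0 \<longrightarrow> a = 0 \<and> b = 0)"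

definition sectional_curvature ::
  "'a metric_tensor \<Rightarrow> 'a conn \<Rightarrow> 'a \<Rightarrow> 'a vfield \<Rightarrow> 'a vfield \<Rightarrow> real" where
  "sectional_curvature g nabla p X Y =
     riemann_tensor g nabla X Y X Y p /
     (inner_fields g X X p * inner_fields g Y Y p - (inner_fields g X Y p)\<^sup>2)"

text \<open>
  A 2-plane in the tangent space at \<open>p\<close> is given by a basis, and each basis is the value at \<open>p\<close>
  of a pair of global vector fields; since the curvature is a tensor, the quotient above depends
  only on the plane spanned by \<open>X p\<close> and \<open>Y p\<close>. Quantifying over all such pairs is
  therefore quantifying over all 2-planes at \<open>p\<close>.
\<close>

definition constant_sectional_curvature ::
  "('a, 'e::euclidean_space) atlas \<Rightarrow> 'a metric_tensor \<Rightarrow> 'a conn \<Rightarrow> real \<Rightarrow> bool" where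
  "constant_sectional_curvature \<A> g nabla c \<longleftrightarrow>
     (\<forall>p\<in>points \<A>. \<forall>X\<in>vector_fields \<A>. \<forall>Y\<in>vector_fields \<A>.
        lin_indep2 (X p) (Y p) \<longrightarrow> sectional_curvature g nabla p X Y = c)"


section \<open>Complex structures\<close>

type_synonym 'a endo_field = "'a \<Rightarrow> 'a tvec \<Rightarrow> 'a tvec"

definition apply_endo :: "'a endo_field \<Rightarrow> 'a vfield \<Rightarrow> 'a vfield" where
  "apply_endo A X = (\<lambda>p. A p (X p))"

text \<open>1-forms with values in the tangent bundle, as smooth fields of endomorphisms.\<close>

definition tangent_one_forms :: "('a, 'e::euclidean_space) atlas \<Rightarrow> 'a endo_field set" where
  "tangent_one_forms \<A> = {A.
     (\<forall>p\<in>points \<A>. \<forall>u\<in>tangent_space \<A> p.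
        A p u \<in> tangent_space \<A> p \<and>
        (\<forall>v\<in>tangent_space \<A> p. A p (u + v) = A p u + A p v) \<and>
        (\<forall>a. A p (scale_vec a u) = scale_vec a (A p u))) \<and>
     (\<forall>p. p \<notin> points \<A> \<longrightarrow> (\<forall>u. A p u = 0)) \<and>
     (\<forall>X\<in>vector_fields \<A>. apply_endo A X \<in> vector_fields \<A>)}"

definition almost_complex_structures :: "('a, 'e::euclidean_space) atlas \<Rightarrow> 'a endo_field set" where
  "almost_complex_structures \<A> =
     {A \<in> tangent_one_forms \<A>. \<forall>p\<in>points \<A>. \<forall>u\<in>tangent_space \<A> p. A p (A p u) = - u}"

definition nijenhuis :: "'a endo_field \<Rightarrow> 'a vfield \<Rightarrow> 'a vfield \<Rightarrow> 'a vfield" where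
  "nijenhuis A X Y =
     lie_bracket (apply_endo A X) (apply_endo A Y)
     - apply_endo A (lie_bracket (apply_endo A X) Y + lie_bracket X (apply_endo A Y))
     - lie_bracket X Y"

definition complex_structures :: "('a, 'e::euclidean_space) atlas \<Rightarrow> 'a endo_field set" where
  "complex_structures \<A> =
     {A \<in> almost_complex_structures \<A>.
        \<forall>X\<in>vector_fields \<A>. \<forall>Y\<in>vector_fields \<A>. nijenhuis A X Y = 0}"

definition cov_deriv_endo :: "'a conn \<Rightarrow> 'a vfield \<Rightarrow> 'a endo_field \<Rightarrow> 'a vfield \<Rightarrow> 'a vfield" where
  "cov_deriv_endo nabla X A Y = nabla X (apply_endo A Y) - apply_endo A (nabla X Y)"

text \<open>The covariant exterior derivative of a 1-form with values in the tangent bundle.\<close>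

definition d_nabla :: "'a conn \<Rightarrow> 'a endo_field \<Rightarrow> 'a vfield \<Rightarrow> 'a vfield \<Rightarrow> 'a vfield" where
  "d_nabla nabla A X Y = cov_deriv_endo nabla X A Y - cov_deriv_endo nabla Y A X"

end

theory Submission
  imports Defs
begin

text \<open>
  Suppose that \<open>A\<close> is an almost-complex structure with \<open>d\<^sup>\<nabla> A = 0\<close>. Applying \<open>d\<^sup>\<nabla>\<close> once more
  and using the Jacobi identity gives
  \<open>R(X,Y) A Z + R(Y,Z) A X + R(Z,X) A Y = 0\<close> (lemma \<open>curvature_cyclic_sum\<close>). If the sectional
  curvature is the constant \<open>c \<noteq> 0\<close>, the symmetries of the curvature force
  \<open>Rm(X,Y,Z,W) = c (g(X,Z) g(Y,W) - g(X,W) g(Y,Z))\<close>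
  (lemma \<open>constant_curvature_riemann_tensor\<close>).

  Now take \<open>u \<noteq> 0\<close> at some point, and \<open>w \<noteq> 0\<close> orthogonal to \<open>u\<close> and \<open>A u\<close>, which exists because
  the dimension exceeds 2. Inserting \<open>w\<close>, \<open>u\<close>, \<open>A u\<close> in the cyclic identity, using
  \<open>A (A u) = - u\<close> and taking the inner product with \<open>w\<close> leaves
  \<open>c g(w,w) (g(u,u) + g(A u,A u)) = 0\<close>, which is a contradiction. Equivalently, \<open>A\<close> would have
  to be self-adjoint, so that \<open>A \<circ> A\<close> could not be negative.

  Curvature is defined on global vector fields, so the vectors above have to be values of such
  fields. Lemma \<open>vector_field_frame\<close> supplies them, cutting off coordinate fields by a smooth bump
  function; this rests on the chain and product rules for the functions described by \<open>Ck_on\<close>.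
  The algebraic identities are first proved between fields and then evaluated at the point, which
  avoids showing that the curvature is a tensor.
\<close>

section \<open>Calculus of continuously differentiable functions\<close>

lemma Ck_on_cong:
  assumes "open S" "Ck_on k S f" "\<And>x. x \<in> S \<Longrightarrow> f x = g x"
  shows "Ck_on k S g"
  using assms(2,3)
proof (induction k arbitrary: f g)
  case 0
  then show ?case by (simp cong: continuous_on_cong)
next
  case (Suc k)
  have der: "(g has_derivative frechet_derivative f (at x)) (at x)" if "x \<in> S" for x
  proof (rule has_derivative_transform_within_open[OF _ \<open>open S\<close> that])
    show "(f has_derivative frechet_derivative f (at x)) (at x)"
      using Suc.prems(1) that frechet_derivative_works by auto
  qed (use Suc.prems(2) in auto)
  have "Ck_on k S (\<lambda>x. frechet_derivative g (at x) v)" for v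
    by (rule Suc.IH[of "\<lambda>x. frechet_derivative f (at x) v"])
      (use Suc.prems(1) frechet_derivative_at[OF der] in auto)
  then show ?case
    using der by (auto simp: differentiable_def)
qed

lemma Ck_on_Suc_if_has_derivative:
  assumes "open S" and der: "\<And>x. x \<in> S \<Longrightarrow> (f has_derivative f' x) (at x)"
    and "\<And>v. Ck_on k S (\<lambda>x. f' x v)"
  shows "Ck_on (Suc k) S f"
proof -
  have "Ck_on k S (\<lambda>x. frechet_derivative f (at x) v)" for v
    by (rule Ck_on_cong[OF assms(1) assms(3)[of v]])
      (use frechet_derivative_at[OF der] in auto)
  then show ?thesis
    using der by (auto simp: differentiable_def)
qed

lemma Ck_on_has_derivative:
  assumes "Ck_on (Suc k) S f" "x \<in> S"
  shows "(f has_derivative frechet_derivative f (at x)) (at x)"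
  using assms frechet_derivative_works by auto

lemma Ck_on_Suc_imp:
  "Ck_on (Suc k) S f \<Longrightarrow> Ck_on k S f"
proof (induction k arbitrary: f)
  case 0
  then show ?case
    by (auto intro!: continuous_at_imp_continuous_on differentiable_imp_continuous_within)
next
  case (Suc k)
  then show ?case by (metis Ck_on.simps(2))
qed

lemma Ck_on_subset:
  "Ck_on k S f \<Longrightarrow> R \<subseteq> S \<Longrightarrow> Ck_on k R f"
proof (induction k arbitrary: f)
  case 0
  then show ?case by (auto intro: continuous_on_subset)
next
  case (Suc k)
  then show ?case by (metis Ck_on.simps(2) subsetD)
qed

lemma Ck_on_locally:
  assumes "\<And>x. x \<in> S \<Longrightarrow> \<exists>N. open N \<and> x \<in> N \<and> Ck_on k N f"
  shows "Ck_on k S f"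
  using assms
proof (induction k arbitrary: f)
  case 0
  then show ?case
    by (simp, intro continuous_at_imp_continuous_on ballI) (metis continuous_on_eq_continuous_at)
next
  case (Suc k)
  have "f differentiable (at x)" if "x \<in> S" for x
    using Suc.prems[OF that] by auto
  moreover have "Ck_on k S (\<lambda>x. frechet_derivative f (at x) v)" for v
  proof (rule Suc.IH)
    fix x assume "x \<in> S"
    with Suc.prems obtain N where "open N" "x \<in> N" "Ck_on (Suc k) N f"
      by blast
    then show "\<exists>N. open N \<and> x \<in> N \<and> Ck_on k N (\<lambda>x. frechet_derivative f (at x) v)"
      by auto
  qed
  ultimately show ?case by simp
qed

lemma Ck_on_const: "open S \<Longrightarrow> Ck_on k S (\<lambda>x. c)"
proof (induction k arbitrary: c)
  case (Suc k)
  show ?case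
    by (rule Ck_on_Suc_if_has_derivative[where f' = "\<lambda>_ _. 0"]) (use Suc in auto)
qed simp

lemma Ck_on_bounded_linear:
  assumes "open S" "bounded_linear L"
  shows "Ck_on k S L"
proof (cases k)
  case 0
  then show ?thesis
    using assms by (simp add: linear_continuous_on)
next
  case (Suc j)
  show ?thesis unfolding Suc
    by (rule Ck_on_Suc_if_has_derivative[where f' = "\<lambda>_. L"])
      (use assms in \<open>auto intro: bounded_linear_imp_has_derivative Ck_on_const\<close>)
qed

lemma Ck_on_bounded_linear_comp:
  assumes "open S" "bounded_linear L" "Ck_on k S f"
  shows "Ck_on k S (\<lambda>x. L (f x))"
  using assms(3)
proof (induction k arbitrary: f)
  case 0
  then show ?case
    using bounded_linear.continuous_on[OF assms(2)] by simp
next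
  case (Suc k)
  show ?case
  proof (rule Ck_on_Suc_if_has_derivative[OF assms(1)])
    show "((\<lambda>x. L (f x)) has_derivative (\<lambda>v. L (frechet_derivative f (at x) v))) (at x)" if "x \<in> S" for x
      by (rule bounded_linear.has_derivative[OF assms(2) Ck_on_has_derivative[OF Suc.prems that]])
  qed (use Suc in auto)
qed

lemma Ck_on_add:
  assumes "open S" "Ck_on k S f" "Ck_on k S g"
  shows "Ck_on k S (\<lambda>x. f x + g x)"
  using assms(2,3)
proof (induction k arbitrary: f g)
  case 0
  then show ?case by (auto intro: continuous_intros)
next
  case (Suc k)
  show ?case
  proof (rule Ck_on_Suc_if_has_derivative[OF assms(1)])
    show "((\<lambda>x. f x + g x) has_derivative
        (\<lambda>v. frechet_derivative f (at x) v + frechet_derivative g (at x) v)) (at x)" if "x \<in> S" for x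
      by (intro has_derivative_add Ck_on_has_derivative[OF Suc.prems(1) that]
          Ck_on_has_derivative[OF Suc.prems(2) that])
  qed (use Suc in auto)
qed

lemma Ck_on_sum:
  assumes "open S" "\<And>i. i \<in> I \<Longrightarrow> Ck_on k S (f i)"
  shows "Ck_on k S (\<lambda>x. \<Sum>i\<in>I. f i x)"
  using assms(2)
  by (induction I rule: infinite_finite_induct)
    (auto intro: Ck_on_const[OF assms(1)] Ck_on_add[OF assms(1)])

lemma Ck_on_scaleR:
  assumes "open S" "Ck_on k S a" "Ck_on k S f"
  shows "Ck_on k S (\<lambda>x. a x *\<^sub>R f x)"
  using assms(2,3)
proof (induction k arbitrary: a f)
  case 0
  then show ?case by (auto intro: continuous_intros)
next
  case (Suc k)
  show ?case
  proof (rule Ck_on_Suc_if_has_derivative[OF assms(1)])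
    show "((\<lambda>x. a x *\<^sub>R f x) has_derivative
        (\<lambda>v. a x *\<^sub>R frechet_derivative f (at x) v + frechet_derivative a (at x) v *\<^sub>R f x)) (at x)"
      if "x \<in> S" for x
      by (intro has_derivative_scaleR Ck_on_has_derivative[OF Suc.prems(1) that]
          Ck_on_has_derivative[OF Suc.prems(2) that])
    show "Ck_on k S (\<lambda>x. a x *\<^sub>R frechet_derivative f (at x) v
        + frechet_derivative a (at x) v *\<^sub>R f x)" for v
      by (intro Ck_on_add[OF assms(1)] Suc.IH) (use Suc.prems Ck_on_Suc_imp in auto)
  qed
qed

text \<open>
  By the chain rule, the derivative of \<open>f \<circ> g\<close> in direction \<open>v\<close> is the derivative of \<open>f\<close> at
  \<open>g x\<close> in direction \<open>Dg v\<close>. Expanding \<open>Dg v\<close> in the standard basis writes it as a sum of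
  products of \<open>C\<^sup>k\<close> functions, each with a directional derivative of \<open>f\<close> in a fixed direction.
\<close>

lemma Ck_on_compose:
  assumes "open S" "open R" "g ` S \<subseteq> R" "Ck_on k R f" "Ck_on k S g"
  shows "Ck_on k S (\<lambda>x. f (g x))"
  using assms(4,5)
proof (induction k arbitrary: f)
  case 0
  then show ?case
    using continuous_on_compose2 assms(3) by auto
next
  case (Suc k)
  let ?f' = "\<lambda>y. frechet_derivative f (at y)" and ?g' = "\<lambda>x. frechet_derivative g (at x)"
  have f': "(f has_derivative ?f' (g x)) (at (g x))" if "x \<in> S" for x
    using Suc.prems(1) assms(3) that by (intro Ck_on_has_derivative) auto
  show ?case
  proof (rule Ck_on_Suc_if_has_derivative[OF assms(1)])
    show "((\<lambda>x. f (g x)) has_derivative (\<lambda>v. ?f' (g x) (?g' x v))) (at x)" if "x \<in> S" for x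
      using has_derivative_compose[OF Ck_on_has_derivative[OF Suc.prems(2) that] f'[OF that]] .
    fix v
    have "Ck_on k S (\<lambda>x. \<Sum>b\<in>Basis. (?g' x v \<bullet> b) *\<^sub>R ?f' (g x) b)"
    proof (intro Ck_on_sum Ck_on_scaleR assms(1))
      fix b :: 'b assume "b \<in> Basis"
      show "Ck_on k S (\<lambda>x. ?g' x v \<bullet> b)"
        by (rule Ck_on_bounded_linear_comp[OF assms(1) bounded_linear_inner_left])
          (use Suc.prems(2) in auto)
      show "Ck_on k S (\<lambda>x. ?f' (g x) b)"
        by (rule Suc.IH) (use Suc.prems Ck_on_Suc_imp in auto)
    qed
    then show "Ck_on k S (\<lambda>x. ?f' (g x) (?g' x v))"
    proof (rule Ck_on_cong[OF assms(1)])
      fix x assume "x \<in> S"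
      then have lin: "linear (?f' (g x))"
        using f' has_derivative_linear by blast
      have "?f' (g x) (?g' x v) = ?f' (g x) (\<Sum>b\<in>Basis. (?g' x v \<bullet> b) *\<^sub>R b)"
        by (simp add: euclidean_representation)
      then show "(\<Sum>b\<in>Basis. (?g' x v \<bullet> b) *\<^sub>R ?f' (g x) b) = ?f' (g x) (?g' x v)"
        by (simp add: linear_sum[OF lin] linear_scale[OF lin])
    qed
  qed
qed

lemma smooth_on_cong:
  "open S \<Longrightarrow> smooth_on S f \<Longrightarrow> (\<And>x. x \<in> S \<Longrightarrow> f x = g x) \<Longrightarrow> smooth_on S g"
  unfolding smooth_on_def using Ck_on_cong by blast

lemma smooth_on_locally:
  assumes "\<And>x. x \<in> S \<Longrightarrow> \<exists>N. open N \<and> x \<in> N \<and> smooth_on N f"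
  shows "smooth_on S f"
  using assms Ck_on_locally unfolding smooth_on_def by metis

lemma smooth_on_compose:
  assumes "open S" "open R" "g ` S \<subseteq> R" "smooth_on R f" "smooth_on S g"
  shows "smooth_on S (\<lambda>x. f (g x))"
  using assms Ck_on_compose unfolding smooth_on_def by metis

lemma smooth_on_subset: "smooth_on S f \<Longrightarrow> R \<subseteq> S \<Longrightarrow> smooth_on R f"
  using Ck_on_subset unfolding smooth_on_def by blast

lemma smooth_on_const: "open S \<Longrightarrow> smooth_on S (\<lambda>x. c)"
  by (simp add: smooth_on_def Ck_on_const)

lemma smooth_on_add:
  "open S \<Longrightarrow> smooth_on S f \<Longrightarrow> smooth_on S g \<Longrightarrow> smooth_on S (\<lambda>x. f x + g x)"
  by (simp add: smooth_on_def Ck_on_add)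

lemma smooth_on_mult:
  fixes f g :: "'e::euclidean_space \<Rightarrow> real"
  assumes "open S" "smooth_on S f" "smooth_on S g"
  shows "smooth_on S (\<lambda>x. f x * g x)"
  using assms Ck_on_scaleR[of S _ f g] by (simp add: smooth_on_def)

lemma smooth_on_frechet_derivative:
  "smooth_on S f \<Longrightarrow> smooth_on S (\<lambda>x. frechet_derivative f (at x) v)"
  unfolding smooth_on_def by (metis Ck_on.simps(2))

lemma smooth_on_imp_differentiable:
  "smooth_on S f \<Longrightarrow> x \<in> S \<Longrightarrow> f differentiable (at x)"
  unfolding smooth_on_def by (metis Ck_on.simps(2))


section \<open>Bump functions\<close>

text \<open>
  The functions \<open>exp (- 1 / t) / t ^ n\<close> for \<open>t > 0\<close>, extended by zero. The case \<open>n = 0\<close> is the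
  usual smooth function that is flat at 0; the whole family is needed because each derivative
  is a combination of members with larger \<open>n\<close>.
\<close>

definition flat_exp :: "nat \<Rightarrow> real \<Rightarrow> real" where
  "flat_exp n t = (if t > 0 then exp (- 1 / t) / t ^ n else 0)"

lemma flat_exp_tendsto_0: "(flat_exp n \<longlongrightarrow> 0) (at_right 0)"
proof -
  have "((\<lambda>t. inverse t ^ n / exp (inverse t)) \<longlongrightarrow> 0) (at_right (0::real))"
    by (rule filterlim_compose[OF tendsto_power_div_exp_0 filterlim_inverse_at_top_right])
  then show ?thesis
    by (rule tendsto_cong[THEN iffD1, rotated])
      (auto simp: eventually_at_filter flat_exp_def exp_minus field_simps)
qed

lemma flat_exp_has_derivative:
  "(flat_exp n has_real_derivative flat_exp (n + 2) t - of_nat n * flat_exp (n + 1) t) (at t)"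
proof (cases t "0::real" rule: linorder_cases)
  case greater
  have "((\<lambda>t. exp (- 1 / t) / t ^ n) has_real_derivative
      flat_exp (n + 2) t - of_nat n * flat_exp (n + 1) t) (at t)"
    using greater
    apply (auto intro!: derivative_eq_intros simp: flat_exp_def)
    apply (cases n; simp add: field_simps power2_eq_square)
    done
  then show ?thesis
    by (rule has_field_derivative_transform_within_open[where S = "{0<..}"])
      (use greater in \<open>auto simp: flat_exp_def\<close>)
next
  case less
  have "((\<lambda>t. 0) has_real_derivative 0) (at t)"
    by simp
  then have "(flat_exp n has_real_derivative 0) (at t)"
    by (rule has_field_derivative_transform_within_open[where S = "{..<0}"])
      (use less in \<open>auto simp: flat_exp_def\<close>)
  with less show ?thesis by (simp add: flat_exp_def)
next
  case equal
  have right: "((\<lambda>y. flat_exp n y / y) \<longlongrightarrow> 0) (at_right 0)"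
    by (rule tendsto_cong[THEN iffD1, OF _ flat_exp_tendsto_0[of "Suc n"]])
      (auto simp: eventually_at_filter flat_exp_def)
  have left: "((\<lambda>y. flat_exp n y / y) \<longlongrightarrow> 0) (at_left 0)"
    by (rule tendsto_cong[THEN iffD1, OF _ tendsto_const])
      (auto simp: eventually_at_filter flat_exp_def)
  have "((\<lambda>y. flat_exp n y / y) \<longlongrightarrow> 0) (at 0)"
    using left right by (rule filterlim_split_at)
  with equal show ?thesis
    by (simp add: has_field_derivative_iff flat_exp_def)
qed

lemma Ck_on_flat_exp: "Ck_on k UNIV (flat_exp n)"
proof (induction k arbitrary: n)
  case 0
  then show ?case
    using flat_exp_has_derivative
    by (auto intro!: continuous_at_imp_continuous_on DERIV_isCont)
next
  case (Suc k)
  show ?case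
  proof (rule Ck_on_Suc_if_has_derivative)
    show "(flat_exp n has_derivative
        (\<lambda>v. v *\<^sub>R (flat_exp (n + 2) t + (- of_nat n) *\<^sub>R flat_exp (n + 1) t))) (at t)" for t
      using flat_exp_has_derivative[of n t]
      by (simp add: has_field_derivative_def mult_commute_abs)
    show "Ck_on k UNIV (\<lambda>t. v *\<^sub>R (flat_exp (n + 2) t + (- of_nat n) *\<^sub>R flat_exp (n + 1) t))" for v
      by (intro Ck_on_scaleR Ck_on_add Ck_on_const Suc.IH open_UNIV)
  qed simp
qed

lemma smooth_bump:
  fixes x :: "'e::euclidean_space"
  assumes "r > 0"
  obtains b :: "'e \<Rightarrow> real" where "smooth_on UNIV b" "b x \<noteq> 0" "\<And>y. y \<notin> cball x r \<Longrightarrow> b y = 0"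
proof
  \<comment> \<open>The value of \<open>?q y\<close> is \<open>r\<^sup>2 - (dist x y)\<^sup>2\<close>, written out as a polynomial in coordinates.\<close>
  let ?q = "\<lambda>y. r\<^sup>2 + (\<Sum>i\<in>Basis. (- 1) *\<^sub>R (y \<bullet> i + - (x \<bullet> i)) *\<^sub>R (y \<bullet> i + - (x \<bullet> i)))"
  have q: "?q y = r\<^sup>2 - (dist x y)\<^sup>2" for y
  proof -
    have "(dist x y)\<^sup>2 = (\<Sum>i\<in>Basis. ((y - x) \<bullet> i) * ((y - x) \<bullet> i))"
      by (simp only: dist_norm norm_minus_commute[of x] power2_norm_eq_inner flip: euclidean_inner)
    then show ?thesis
      by (simp add: inner_diff_left sum_negf del: minus_mult_minus)
  qed
  show "smooth_on UNIV (\<lambda>y. flat_exp 0 (?q y))"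
    unfolding smooth_on_def
  proof (intro allI Ck_on_compose[OF _ _ _ Ck_on_flat_exp])
    show "Ck_on k UNIV ?q" for k
      by (intro Ck_on_add Ck_on_sum Ck_on_scaleR Ck_on_const Ck_on_bounded_linear
          bounded_linear_inner_left open_UNIV)
  qed auto
  show "flat_exp 0 (?q x) \<noteq> 0"
    using assms by (simp add: flat_exp_def)
  show "flat_exp 0 (?q y) = 0" if "y \<notin> cball x r" for y
  proof -
    have "r\<^sup>2 < (dist x y)\<^sup>2"
      using that assms by (intro power_strict_mono) auto
    then show ?thesis unfolding q by (simp add: flat_exp_def)
  qed
qed


section \<open>Smooth functions on a manifold\<close>

text \<open>A smooth manifold \<open>T\<close> with an atlas, which need not be maximal.\<close>

locale smooth_mfd =
  fixes T :: "'a topology" and \<A> :: "('a, 'e::euclidean_space) atlas"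
  assumes smooth_manifold: "smooth_manifold T \<A>"
begin

lemma points_eq_topspace: "points \<A> = topspace T"
  using smooth_manifold by (simp add: smooth_manifold_def points_def)

context
  fixes U \<phi>
  assumes chart: "(U, \<phi>) \<in> \<A>"
begin

lemma chart_openin: "openin T U" and chart_open_range: "open (\<phi> ` U)"
  and chart_homeomorphic: "homeomorphic_map (subtopology T U) (top_of_set (\<phi> ` U)) \<phi>"
  using smooth_manifold chart unfolding smooth_manifold_def by fast+

lemma chart_subset: "U \<subseteq> topspace T"
  using chart_openin by (rule openin_subset)

lemma chart_inj: "inj_on \<phi> U"
  using homeomorphic_imp_injective_map[OF chart_homeomorphic] chart_subset
  by (simp add: Int_absorb1)

lemma chart_inverse [simp]: "p \<in> U \<Longrightarrow> inv_into U \<phi> (\<phi> p) = p"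
  using chart_inj by simp

lemma chart_open_image:
  assumes "openin T W" "W \<subseteq> U"
  shows "open (\<phi> ` W)"
proof -
  have "openin (subtopology T U) W"
    using assms by (metis openin_subset_topspace_eq openin_subtopology inf.absorb1)
  then have "openin (top_of_set (\<phi> ` U)) (\<phi> ` W)"
    using homeomorphic_imp_open_map[OF chart_homeomorphic] by (simp add: open_map_def)
  then show ?thesis
    using chart_open_range by (simp add: openin_open_eq)
qed

lemma smooth_funs_in_chart: "f \<in> smooth_funs \<A> \<Longrightarrow> smooth_on (\<phi> ` U) (f \<circ> inv_into U \<phi>)"
  using chart by (auto simp: smooth_funs_def)

lemma closedin_chart_preimage:
  assumes "compact K" "K \<subseteq> \<phi> ` U"
  shows "closedin T {p \<in> U. \<phi> p \<in> K}"
proof -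
  let ?C = "{p \<in> U. \<phi> p \<in> K}"
  have img: "\<phi> ` ?C = K"
    using assms(2) by auto
  have "?C \<subseteq> topspace (subtopology T U)"
    using chart_subset by auto
  moreover have "compactin (top_of_set (\<phi> ` U)) (\<phi> ` ?C)"
    unfolding img using assms by (simp add: compactin_subtopology)
  ultimately have "compactin (subtopology T U) ?C"
    using homeomorphic_map_compactness[OF chart_homeomorphic] by blast
  then have "compactin T ?C"
    by (simp add: compactin_subtopology)
  then show ?thesis
    using smooth_manifold compactin_imp_closedin by (auto simp: smooth_manifold_def)
qed

text \<open>
  A smooth function in a chart that vanishes off a compact subset of the chart, extended by zero.
  At a point outside of the chart domain it vanishes in a neighbourhood, since the compact set is
  closed in \<open>T\<close>, which is Hausdorff.
\<close>

lemma extend_by_zero_in_smooth_funs: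
  assumes F: "smooth_on (\<phi> ` U) F" and K: "compact K" "K \<subseteq> \<phi> ` U"
    and zero: "\<And>y. y \<in> \<phi> ` U \<Longrightarrow> y \<notin> K \<Longrightarrow> F y = 0"
  shows "(\<lambda>p. if p \<in> U then F (\<phi> p) else 0) \<in> smooth_funs \<A>" (is "?f \<in> _")
proof -
  let ?C = "{p \<in> U. \<phi> p \<in> K}"
  have "smooth_on (\<psi> ` V) (?f \<circ> inv_into V \<psi>)" if V: "(V, \<psi>) \<in> \<A>" for V \<psi>
  proof (rule smooth_on_locally)
    fix y assume "y \<in> \<psi> ` V"
    then obtain q where q: "q \<in> V" "y = \<psi> q" by auto
    have inv: "inv_into V \<psi> (\<psi> p) = p" if "p \<in> V" for p
      using smooth_mfd.chart_inverse[OF smooth_mfd_axioms V that] .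
    note image_open = smooth_mfd.chart_open_image[OF smooth_mfd_axioms V]
    note V_open = smooth_mfd.chart_openin[OF smooth_mfd_axioms V]
    show "\<exists>N. open N \<and> y \<in> N \<and> smooth_on N (?f \<circ> inv_into V \<psi>)"
    proof (cases "q \<in> U")
      case True
      let ?N = "\<psi> ` (V \<inter> U)"
      have N: "open ?N"
        by (rule image_open) (use V_open chart_openin in auto)
      have "smooth_on ?N (\<phi> \<circ> inv_into V \<psi>)"
        using smooth_manifold V chart unfolding smooth_manifold_def by fast
      then have "smooth_on ?N (\<lambda>z. F ((\<phi> \<circ> inv_into V \<psi>) z))"
        by (rule smooth_on_compose[OF N chart_open_range _ F, rotated]) (auto simp: inv)
      then have "smooth_on ?N (?f \<circ> inv_into V \<psi>)"
        by (rule smooth_on_cong[OF N]) (auto simp: inv)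
      then show ?thesis
        using N q True by blast
    next
      case False
      let ?N = "\<psi> ` (V - ?C)"
      have N: "open ?N"
        by (rule image_open) (use V_open closedin_chart_preimage[OF K] in \<open>auto intro: openin_diff\<close>)
      have "smooth_on ?N (\<lambda>z. 0)"
        by (simp add: smooth_on_def Ck_on_const[OF N])
      then have "smooth_on ?N (?f \<circ> inv_into V \<psi>)"
      proof (rule smooth_on_cong[OF N])
        fix z assume "z \<in> ?N"
        then obtain p where "p \<in> V" "p \<notin> ?C" "z = \<psi> p"
          by blast
        then show "0 = (?f \<circ> inv_into V \<psi>) z"
          using zero[of "\<phi> p"] by (auto simp: inv)
      qed
      then show ?thesis
        using N q False by blast
    qed
  qed
  then show ?thesis
    using chart by (auto simp: smooth_funs_def points_def)
qed

end

lemma smooth_funs_add: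
  assumes "f \<in> smooth_funs \<A>" "h \<in> smooth_funs \<A>"
  shows "f + h \<in> smooth_funs \<A>"
proof -
  have "smooth_on (\<phi> ` U) ((f + h) \<circ> inv_into U \<phi>)" if "(U, \<phi>) \<in> \<A>" for U \<phi>
    using smooth_on_add[OF chart_open_range[OF that]] assms[THEN smooth_funs_in_chart[OF that]]
    by (simp add: comp_def)
  then show ?thesis
    using assms by (auto simp: smooth_funs_def)
qed

lemma smooth_funs_mult:
  assumes "f \<in> smooth_funs \<A>" "h \<in> smooth_funs \<A>"
  shows "f * h \<in> smooth_funs \<A>"
proof -
  have "smooth_on (\<phi> ` U) ((f * h) \<circ> inv_into U \<phi>)" if "(U, \<phi>) \<in> \<A>" for U \<phi>
    using smooth_on_mult[OF chart_open_range[OF that]] assms[THEN smooth_funs_in_chart[OF that]]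
    by (simp add: comp_def)
  then show ?thesis
    using assms by (auto simp: smooth_funs_def)
qed

lemma smooth_funs_scale:
  assumes "f \<in> smooth_funs \<A>"
  shows "(\<lambda>p. a * f p) \<in> smooth_funs \<A>"
proof -
  have "smooth_on (\<phi> ` U) ((\<lambda>p. a * f p) \<circ> inv_into U \<phi>)" if "(U, \<phi>) \<in> \<A>" for U \<phi>
    using smooth_on_mult[OF chart_open_range[OF that] smooth_on_const[OF chart_open_range[OF that]]]
      assms[THEN smooth_funs_in_chart[OF that]]
    by (simp add: comp_def)
  then show ?thesis
    using assms by (auto simp: smooth_funs_def)
qed

lemma smooth_funs_uminus: "f \<in> smooth_funs \<A> \<Longrightarrow> - f \<in> smooth_funs \<A>"
  using smooth_funs_scale[of f "- 1"] by (simp add: fun_Compl_def)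


section \<open>Vector fields supported in a chart\<close>

text \<open>
  The vector field \<open>b \<partial>\<^sub>v\<close> in the chart \<open>\<phi>\<close>, extended by zero outside of the chart domain; here
  \<open>b\<close> is a function of the coordinates. It takes the value 0 on functions that are not smooth, as
  tangent vectors do by convention.
\<close>

definition chart_field :: "'a set \<Rightarrow> ('a \<Rightarrow> 'e) \<Rightarrow> ('e \<Rightarrow> real) \<Rightarrow> 'e \<Rightarrow> 'a vfield" where
  "chart_field U \<phi> b v = (\<lambda>p f. if p \<in> U \<and> f \<in> smooth_funs \<A>
     then b (\<phi> p) * frechet_derivative (f \<circ> inv_into U \<phi>) (at (\<phi> p)) v else 0)"

lemma frechet_derivative_in_chart:
  assumes "(U, \<phi>) \<in> \<A>" "f \<in> smooth_funs \<A>" "p \<in> U"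
  shows "((f \<circ> inv_into U \<phi>) has_derivative frechet_derivative (f \<circ> inv_into U \<phi>) (at (\<phi> p))) (at (\<phi> p))"
  using smooth_on_imp_differentiable[OF smooth_funs_in_chart[OF assms(1,2)]] assms(3)
    frechet_derivative_works by blast

lemma chart_field_in_tangent_space:
  assumes chart: "(U, \<phi>) \<in> \<A>"
  shows "chart_field U \<phi> b v p \<in> tangent_space \<A> p"
proof (cases "p \<in> U")
  case False
  then show ?thesis
    by (simp add: chart_field_def tangent_space_def)
next
  case True
  let ?i = "inv_into U \<phi>"
  let ?D = "\<lambda>f. frechet_derivative (f \<circ> ?i) (at (\<phi> p))"
  note D = frechet_derivative_in_chart[OF chart _ True]
  have [simp]: "?i (\<phi> p) = p"
    by (rule chart_inverse[OF chart True])
  have add: "?D (f + h) = (\<lambda>v. ?D f v + ?D h v)"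
    if "f \<in> smooth_funs \<A>" "h \<in> smooth_funs \<A>" for f h
    using frechet_derivative_at[OF has_derivative_add[OF D[OF that(1)] D[OF that(2)]]]
    by (simp add: comp_def plus_fun_def)
  have scale: "?D (\<lambda>q. a * f q) = (\<lambda>v. a * ?D f v)" if "f \<in> smooth_funs \<A>" for f a
    using frechet_derivative_at[OF has_derivative_mult_right[OF D[OF that]]]
    by (simp add: comp_def)
  have mult: "?D (f * h) = (\<lambda>v. f p * ?D h v + ?D f v * h p)"
    if "f \<in> smooth_funs \<A>" "h \<in> smooth_funs \<A>" for f h
    using frechet_derivative_at[OF has_derivative_mult[OF D[OF that(1)] D[OF that(2)]]]
    by (simp add: comp_def times_fun_def)
  show ?thesis
    using True
    by (simp add: chart_field_def tangent_space_def add scale mult smooth_funs_add smooth_funs_mult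
        smooth_funs_scale algebra_simps)
qed

lemma chart_field_in_vector_fields:
  assumes chart: "(U, \<phi>) \<in> \<A>" and b: "smooth_on UNIV b"
    and K: "compact K" "K \<subseteq> \<phi> ` U" "\<And>y. y \<notin> K \<Longrightarrow> b y = 0"
  shows "chart_field U \<phi> b v \<in> vector_fields \<A>"
proof -
  have "deriv_along (chart_field U \<phi> b v) f \<in> smooth_funs \<A>" if f: "f \<in> smooth_funs \<A>" for f
  proof -
    let ?F = "\<lambda>y. b y * frechet_derivative (f \<circ> inv_into U \<phi>) (at y) v"
    have "smooth_on (\<phi> ` U) b"
      using smooth_on_subset[OF b] by blast
    then have "smooth_on (\<phi> ` U) ?F"
      by (intro smooth_on_mult smooth_on_frechet_derivative smooth_funs_in_chart
          chart_open_range chart f)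
    then have "(\<lambda>p. if p \<in> U then ?F (\<phi> p) else 0) \<in> smooth_funs \<A>"
      by (rule extend_by_zero_in_smooth_funs[OF chart _ K(1,2)]) (simp add: K(3))
    then show ?thesis
      using f by (simp add: deriv_along_def chart_field_def)
  qed
  moreover have "chart_field U \<phi> b v p = 0" if "p \<notin> points \<A>" for p
    using that chart by (auto simp: chart_field_def points_def fun_eq_iff)
  ultimately show ?thesis
    using chart_field_in_tangent_space[OF chart] by (simp add: vector_fields_def)
qed

text \<open>
  Global vector fields \<open>E v\<close> depending on \<open>v\<close> in such a way that \<open>v \<mapsto> E v p\<close> is linear and
  injective, so that global fields realize at \<open>p\<close> a space of dimension \<open>DIM('e)\<close>. They are
  \<open>b \<partial>\<^sub>v\<close> for a bump function \<open>b\<close>.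
\<close>

lemma vector_field_frame:
  assumes "p \<in> points \<A>"
  obtains E :: "'e \<Rightarrow> 'a vfield"
    where "\<And>v. E v \<in> vector_fields \<A>"
      and "\<And>v w. E (v + w) p = E v p + E w p"
      and "\<And>a v. E (a *\<^sub>R v) p = scale_vec a (E v p)"
      and "\<And>v. v \<noteq> 0 \<Longrightarrow> E v p \<noteq> 0"
proof -
  obtain U \<phi> where chart: "(U, \<phi>) \<in> \<A>" and p: "p \<in> U"
    using assms by (auto simp: points_def)
  obtain r where r: "r > 0" "cball (\<phi> p) r \<subseteq> \<phi> ` U"
    using chart_open_range[OF chart] p by (meson image_eqI open_contains_cball_eq)
  obtain b :: "'e \<Rightarrow> real" where b: "smooth_on UNIV b" "b (\<phi> p) \<noteq> 0"
    "\<And>y. y \<notin> cball (\<phi> p) r \<Longrightarrow> b y = 0"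
    using smooth_bump[OF r(1)] by metis
  let ?E = "chart_field U \<phi> b"
  show thesis
  proof
    show "?E v \<in> vector_fields \<A>" for v
      by (rule chart_field_in_vector_fields[OF chart b(1) _ r(2) b(3)]) auto
    have lin: "linear (frechet_derivative (f \<circ> inv_into U \<phi>) (at (\<phi> p)))" if "f \<in> smooth_funs \<A>" for f
      using frechet_derivative_in_chart[OF chart that p] has_derivative_linear by blast
    show "?E (v + w) p = ?E v p + ?E w p" for v w
      by (auto simp: chart_field_def fun_eq_iff linear_add[OF lin] algebra_simps)
    show "?E (a *\<^sub>R v) p = scale_vec a (?E v p)" for a v
      by (auto simp: chart_field_def fun_eq_iff scale_vec_def linear_scale[OF lin])
    show "?E v p \<noteq> 0" if "v \<noteq> 0" for v
    proof -
      \<comment> \<open>A cut-off linear coordinate, on which \<open>E v p\<close> does not vanish.\<close>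
      let ?F = "\<lambda>y. b y * ((y - \<phi> p) \<bullet> v)"
      let ?f = "\<lambda>q. if q \<in> U then ?F (\<phi> q) else 0"
      have lin_smooth: "smooth_on UNIV (\<lambda>y. (y - \<phi> p) \<bullet> v)"
        unfolding smooth_on_def inner_diff_left diff_conv_add_uminus[of "_ \<bullet> v"]
        by (intro allI Ck_on_add Ck_on_const Ck_on_bounded_linear bounded_linear_inner_left open_UNIV)
      then have F: "smooth_on UNIV ?F"
        by (intro smooth_on_mult b(1) open_UNIV)
      then have "smooth_on (\<phi> ` U) ?F"
        using smooth_on_subset by blast
      then have f: "?f \<in> smooth_funs \<A>"
        by (rule extend_by_zero_in_smooth_funs[OF chart _ compact_cball r(2)]) (use b(3) in auto)
      obtain b' where b': "(b has_derivative b') (at (\<phi> p))"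
        using smooth_on_imp_differentiable[OF b(1)] by (auto simp: differentiable_def)
      have "(?F has_derivative (\<lambda>w. b (\<phi> p) * (w \<bullet> v))) (at (\<phi> p))"
        by (auto intro!: derivative_eq_intros b')
      then have "((?f \<circ> inv_into U \<phi>) has_derivative (\<lambda>w. b (\<phi> p) * (w \<bullet> v))) (at (\<phi> p))"
        by (rule has_derivative_transform_within_open[OF _ chart_open_range[OF chart]])
          (use p chart_inverse[OF chart] in auto)
      then have "?E v p ?f = b (\<phi> p) * (b (\<phi> p) * (v \<bullet> v))"
        using f p by (simp add: chart_field_def flip: frechet_derivative_at)
      then show ?thesis
        using b(2) that by (auto simp: fun_eq_iff intro!: exI[of _ ?f])
    qed
  qed
qed

end


section \<open>Algebraic curvature forms\<close>

text \<open>
  A form with the symmetries of the Riemann tensor is determined by its values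
  \<open>B X Y X Y\<close>. The form is defined on a set \<open>V\<close> that is only required to be closed under addition,
  because it is applied to global vector fields rather than to tangent vectors.
\<close>

lemma curvature_like_form_zero:
  fixes B :: "'v::ab_semigroup_add \<Rightarrow> 'v \<Rightarrow> 'v \<Rightarrow> 'v \<Rightarrow> real"
  assumes V: "\<And>X Y. X \<in> V \<Longrightarrow> Y \<in> V \<Longrightarrow> X + Y \<in> V"
    and add: "\<And>X X' Y Z W. \<lbrakk>X \<in> V; X' \<in> V; Y \<in> V; Z \<in> V; W \<in> V\<rbrakk> \<Longrightarrow> B (X + X') Y Z W = B X Y Z W + B X' Y Z W"
      "\<And>X Y Z Z' W. \<lbrakk>X \<in> V; Y \<in> V; Z \<in> V; Z' \<in> V; W \<in> V\<rbrakk> \<Longrightarrow> B X Y (Z + Z') W = B X Y Z W + B X Y Z' W"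
    and skew: "\<And>X Y Z W. \<lbrakk>X \<in> V; Y \<in> V; Z \<in> V; W \<in> V\<rbrakk> \<Longrightarrow> B Y X Z W = - B X Y Z W"
      "\<And>X Y Z W. \<lbrakk>X \<in> V; Y \<in> V; Z \<in> V; W \<in> V\<rbrakk> \<Longrightarrow> B X Y W Z = - B X Y Z W"
    and bianchi: "\<And>X Y Z W. \<lbrakk>X \<in> V; Y \<in> V; Z \<in> V; W \<in> V\<rbrakk> \<Longrightarrow> B X Y Z W + B Y Z X W + B Z X Y W = 0"
    and diag: "\<And>X Y. \<lbrakk>X \<in> V; Y \<in> V\<rbrakk> \<Longrightarrow> B X Y X Y = 0"
    and mem: "X \<in> V" "Y \<in> V" "Z \<in> V" "W \<in> V"
  shows "B X Y Z W = 0"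
proof -
  \<comment> \<open>Pair symmetry follows from the four Bianchi identities obtained by rotating the arguments.\<close>
  have pair: "B X Y Z W = B Z W X Y" if "X \<in> V" "Y \<in> V" "Z \<in> V" "W \<in> V" for X Y Z W
    using bianchi[OF that] bianchi[OF that(2,3,4,1)] bianchi[OF that(3,4,1,2)] bianchi[OF that(4,1,2,3)]
      skew(1)[OF that(1,3,2,4)] skew(1)[OF that(2,4,3,1)] skew(1)[OF that(1,4,3,2)]
      skew(1)[OF that(1,4,2,3)] skew(2)[OF that] skew(2)[OF that(2,3,1,4)] skew(2)[OF that(3,4,1,2)]
      skew(2)[OF that(2,4,1,3)] skew(2)[OF that(1,4,2,3)] skew(2)[OF that(1,3,2,4)]
    by linarith
  \<comment> \<open>Polarization in the second and fourth arguments.\<close>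
  have half: "B X Y X W = 0" if "X \<in> V" "Y \<in> V" "W \<in> V" for X Y W
  proof -
    have "B (Y + W) X (Y + W) X = B Y X Y X + B Y X W X + (B W X Y X + B W X W X)"
      using that by (simp add: add V)
    then have "B Y X W X = 0"
      using pair[OF that(2,1,3,1)] diag[OF V[OF that(2,3)] that(1)] diag[OF that(2,1)] diag[OF that(3,1)]
      by linarith
    then show ?thesis
      using skew(1)[OF that(2,1,3,1)] skew(2)[OF that(1,2,3,1)] by linarith
  qed
  \<comment> \<open>Polarization in the first and third arguments.\<close>
  have swap: "B X Y Z W = - B Z Y X W" if "X \<in> V" "Y \<in> V" "Z \<in> V" "W \<in> V" for X Y Z W
  proof -
    have "B (X + Z) Y (X + Z) W = B X Y X W + B X Y Z W + (B Z Y X W + B Z Y Z W)"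
      using that by (simp add: add V)
    then show ?thesis
      using half[OF V[OF that(1,3)] that(2,4)] half[OF that(1,2,4)] half[OF that(3,2,4)] by linarith
  qed
  \<comment> \<open>Hence the three terms of the Bianchi identity are equal.\<close>
  show ?thesis
    using bianchi[OF mem] swap[OF mem] swap[OF mem(2,3,1,4)]
      skew(1)[OF mem(2,3,1,4)] skew(1)[OF mem(3,1,2,4)] by linarith
qed


section \<open>Identities for the Levi-Civita connection\<close>

text \<open>A manifold with a Riemannian metric and its Levi-Civita connection.\<close>

locale levi_civita_mfd = smooth_mfd T \<A>
  for T :: "'a topology" and \<A> :: "('a, 'e::euclidean_space) atlas" +
  fixes g :: "'a metric_tensor" and nabla :: "'a conn"
  assumes metric: "riemannian_metric \<A> g" and levi_civita: "levi_civita \<A> g nabla"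
begin

abbreviation "VF \<equiv> vector_fields \<A>"

lemma tangent_space_add:
  "u \<in> tangent_space \<A> p \<Longrightarrow> v \<in> tangent_space \<A> p \<Longrightarrow> u + v \<in> tangent_space \<A> p"
  by (simp add: tangent_space_def algebra_simps)

lemma tangent_space_uminus: "u \<in> tangent_space \<A> p \<Longrightarrow> - u \<in> tangent_space \<A> p"
  by (simp add: tangent_space_def algebra_simps)

lemma VF_tangent: "X \<in> VF \<Longrightarrow> p \<in> points \<A> \<Longrightarrow> X p \<in> tangent_space \<A> p"
  by (simp add: vector_fields_def)

lemma VF_deriv_along: "X \<in> VF \<Longrightarrow> f \<in> smooth_funs \<A> \<Longrightarrow> deriv_along X f \<in> smooth_funs \<A>"
  by (simp add: vector_fields_def)

lemma VF_add: "X \<in> VF \<Longrightarrow> Y \<in> VF \<Longrightarrow> X + Y \<in> VF"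
proof -
  assume XY: "X \<in> VF" "Y \<in> VF"
  have "deriv_along (X + Y) f = deriv_along X f + deriv_along Y f" for f
    by (simp add: deriv_along_def fun_eq_iff)
  then show ?thesis
    using XY smooth_funs_add tangent_space_add by (simp add: vector_fields_def)
qed

lemma VF_uminus: "X \<in> VF \<Longrightarrow> - X \<in> VF"
proof -
  assume X: "X \<in> VF"
  have "deriv_along (- X) f = - deriv_along X f" for f
    by (simp add: deriv_along_def fun_eq_iff)
  then show ?thesis
    using X smooth_funs_uminus tangent_space_uminus by (simp add: vector_fields_def)
qed

lemma VF_diff: "X \<in> VF \<Longrightarrow> Y \<in> VF \<Longrightarrow> X - Y \<in> VF"
  using VF_add[OF _ VF_uminus] by (simp add: diff_conv_add_uminus del: add_uminus_conv_diff)

lemma nabla_in_VF: "X \<in> VF \<Longrightarrow> Y \<in> VF \<Longrightarrow> nabla X Y \<in> VF"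
  and nabla_add_left: "\<lbrakk>X \<in> VF; Y \<in> VF; Z \<in> VF\<rbrakk> \<Longrightarrow> nabla (X + Y) Z = nabla X Z + nabla Y Z"
  and nabla_add_right: "\<lbrakk>X \<in> VF; Y \<in> VF; Z \<in> VF\<rbrakk> \<Longrightarrow> nabla X (Y + Z) = nabla X Y + nabla X Z"
  using levi_civita unfolding levi_civita_def connection_def by blast+

lemma nabla_diff_right:
  "\<lbrakk>X \<in> VF; Y \<in> VF; Z \<in> VF\<rbrakk> \<Longrightarrow> nabla X (Y - Z) = nabla X Y - nabla X Z"
  using nabla_add_right[of X "Y - Z" Z] VF_diff by (simp add: algebra_simps)

lemma lie_bracket_eq: "\<lbrakk>X \<in> VF; Y \<in> VF\<rbrakk> \<Longrightarrow> lie_bracket X Y = nabla X Y - nabla Y X"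
  using levi_civita unfolding levi_civita_def by simp

lemma lie_bracket_in_VF: "\<lbrakk>X \<in> VF; Y \<in> VF\<rbrakk> \<Longrightarrow> lie_bracket X Y \<in> VF"
  by (simp add: lie_bracket_eq nabla_in_VF VF_diff)

lemma VF_apply_add:
  "\<lbrakk>X \<in> VF; f \<in> smooth_funs \<A>; h \<in> smooth_funs \<A>\<rbrakk> \<Longrightarrow> X p (f + h) = X p f + X p h"
  by (cases "p \<in> points \<A>") (auto simp: vector_fields_def tangent_space_def)

lemma VF_apply_diff:
  "\<lbrakk>X \<in> VF; f \<in> smooth_funs \<A>; h \<in> smooth_funs \<A>\<rbrakk> \<Longrightarrow> X p (f - h) = X p f - X p h"
  using VF_apply_add[of X "f - h" h p] smooth_funs_add[OF _ smooth_funs_uminus, of f h] by simp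

lemma VF_apply_not_smooth: "\<lbrakk>X \<in> VF; f \<notin> smooth_funs \<A>\<rbrakk> \<Longrightarrow> X p f = 0"
  by (cases "p \<in> points \<A>") (auto simp: vector_fields_def tangent_space_def)

lemma deriv_along_lie_bracket:
  "deriv_along (lie_bracket X Y) f = deriv_along X (deriv_along Y f) - deriv_along Y (deriv_along X f)"
  by (simp add: deriv_along_def lie_bracket_def fun_eq_iff)

lemma jacobi_identity:
  assumes X: "X \<in> VF" and Y: "Y \<in> VF" and Z: "Z \<in> VF"
  shows "lie_bracket X (lie_bracket Y Z) + lie_bracket Y (lie_bracket Z X)
    + lie_bracket Z (lie_bracket X Y) = 0"
proof (intro ext)
  fix p f
  have *: "lie_bracket X (lie_bracket Y Z) p f =
      X p (deriv_along Y (deriv_along Z f)) - X p (deriv_along Z (deriv_along Y f))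
      - (Y p (deriv_along Z (deriv_along X f)) - Z p (deriv_along Y (deriv_along X f)))"
    if "X \<in> VF" "Y \<in> VF" "Z \<in> VF" "f \<in> smooth_funs \<A>" for X Y Z
    using that
    by (simp add: lie_bracket_def[of X] deriv_along_lie_bracket VF_apply_diff VF_deriv_along)
      (simp add: lie_bracket_def)
  show "(lie_bracket X (lie_bracket Y Z) + lie_bracket Y (lie_bracket Z X)
      + lie_bracket Z (lie_bracket X Y)) p f = 0 p f"
  proof (cases "f \<in> smooth_funs \<A>")
    case True
    then show ?thesis
      by (simp add: * X Y Z)
  next
    case False
    then show ?thesis
      using X Y Z by (simp add: VF_apply_not_smooth lie_bracket_in_VF)
  qed
qed

lemma curvature_in_VF: "\<lbrakk>X \<in> VF; Y \<in> VF; Z \<in> VF\<rbrakk> \<Longrightarrow> curvature nabla X Y Z \<in> VF"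
  by (simp add: curvature_def nabla_in_VF lie_bracket_in_VF VF_diff)

text \<open>
  A tangent-bundle valued 1-form \<open>F\<close>, given by its action on vector fields, satisfies
  \<open>d\<^sup>\<nabla> d\<^sup>\<nabla> F = R \<and> F\<close>, so that \<open>d\<^sup>\<nabla> F = 0\<close> implies \<open>R \<and> F = 0\<close>. As \<open>\<nabla>\<close> is torsion-free,
  assumption \<open>closed\<close> says that \<open>d\<^sup>\<nabla> F = 0\<close>. For \<open>F = id\<close> the conclusion is the first Bianchi
  identity.
\<close>

lemma curvature_cyclic_sum:
  assumes F: "\<And>X. X \<in> VF \<Longrightarrow> F X \<in> VF"
    and F_add: "\<And>X Y. \<lbrakk>X \<in> VF; Y \<in> VF\<rbrakk> \<Longrightarrow> F (X + Y) = F X + F Y"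
    and closed: "\<And>X Y. \<lbrakk>X \<in> VF; Y \<in> VF\<rbrakk> \<Longrightarrow> nabla X (F Y) - nabla Y (F X) = F (lie_bracket X Y)"
    and X: "X \<in> VF" and Y: "Y \<in> VF" and Z: "Z \<in> VF"
  shows "curvature nabla X Y (F Z) + curvature nabla Y Z (F X) + curvature nabla Z X (F Y) = 0"
proof -
  note mem = X Y Z F nabla_in_VF lie_bracket_in_VF VF_add
  have F0: "F 0 = 0"
    using F_add[of "X - X" "X - X"] VF_diff[OF X X] by simp
  \<comment> \<open>Regrouping the cyclic sum by the outer derivative; the terms on the right add up to \<open>F\<close>
    applied to a Jacobi sum.\<close>
  have *: "nabla X (nabla Y (F Z)) - nabla X (nabla Z (F Y)) - nabla (lie_bracket Y Z) (F X)
      = F (lie_bracket X (lie_bracket Y Z))"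
    if "X \<in> VF" "Y \<in> VF" "Z \<in> VF" for X Y Z
    using that closed[of Y Z] closed[of X "lie_bracket Y Z"]
    by (simp add: mem flip: nabla_diff_right)
  have "curvature nabla X Y (F Z) + curvature nabla Y Z (F X) + curvature nabla Z X (F Y)
      = F (lie_bracket X (lie_bracket Y Z)) + F (lie_bracket Y (lie_bracket Z X))
        + F (lie_bracket Z (lie_bracket X Y))"
    unfolding *[OF X Y Z, symmetric] *[OF Y Z X, symmetric] *[OF Z X Y, symmetric] curvature_def
    by (simp add: algebra_simps)
  also have "\<dots> = F (lie_bracket X (lie_bracket Y Z) + lie_bracket Y (lie_bracket Z X)
        + lie_bracket Z (lie_bracket X Y))"
    by (simp add: F_add mem)
  also have "\<dots> = 0"
    by (simp only: jacobi_identity[OF X Y Z] F0)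
  finally show ?thesis .
qed

lemma first_bianchi:
  "\<lbrakk>X \<in> VF; Y \<in> VF; Z \<in> VF\<rbrakk> \<Longrightarrow> curvature nabla X Y Z + curvature nabla Y Z X + curvature nabla Z X Y = 0"
  by (rule curvature_cyclic_sum[where F = "\<lambda>X. X"]) (simp_all only: lie_bracket_eq)

lemma lie_bracket_skew: "lie_bracket Y X = - lie_bracket X Y"
  by (simp add: lie_bracket_def fun_eq_iff)

lemma lie_bracket_add_left:
  "\<lbrakk>X \<in> VF; X' \<in> VF; Y \<in> VF\<rbrakk> \<Longrightarrow> lie_bracket (X + X') Y = lie_bracket X Y + lie_bracket X' Y"
  by (simp add: lie_bracket_eq nabla_add_left nabla_add_right VF_add)

lemma nabla_uminus_left: "\<lbrakk>X \<in> VF; Y \<in> VF\<rbrakk> \<Longrightarrow> nabla (- X) Y = - nabla X Y"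
  using nabla_add_left[of "- X" X Y] nabla_add_left[of "X - X" "X - X" Y] VF_diff[of X X]
  by (simp add: VF_uminus eq_neg_iff_add_eq_0 add.commute)

lemma curvature_skew:
  "\<lbrakk>X \<in> VF; Y \<in> VF; Z \<in> VF\<rbrakk> \<Longrightarrow> curvature nabla Y X Z = - curvature nabla X Y Z"
  by (simp add: curvature_def lie_bracket_skew[of Y X] nabla_uminus_left lie_bracket_in_VF)

lemma curvature_add_left:
  "\<lbrakk>X \<in> VF; X' \<in> VF; Y \<in> VF; Z \<in> VF\<rbrakk>
    \<Longrightarrow> curvature nabla (X + X') Y Z = curvature nabla X Y Z + curvature nabla X' Y Z"
  by (simp add: curvature_def lie_bracket_add_left nabla_add_left nabla_add_right nabla_in_VF
      lie_bracket_in_VF)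

lemma curvature_add_right:
  "\<lbrakk>X \<in> VF; Y \<in> VF; Z \<in> VF; Z' \<in> VF\<rbrakk>
    \<Longrightarrow> curvature nabla X Y (Z + Z') = curvature nabla X Y Z + curvature nabla X Y Z'"
  by (simp add: curvature_def nabla_add_right nabla_in_VF lie_bracket_in_VF)

lemma metric_sym:
  "\<lbrakk>p \<in> points \<A>; u \<in> tangent_space \<A> p; v \<in> tangent_space \<A> p\<rbrakk> \<Longrightarrow> g p u v = g p v u"
  and metric_add_left:
  "\<lbrakk>p \<in> points \<A>; u \<in> tangent_space \<A> p; v \<in> tangent_space \<A> p; w \<in> tangent_space \<A> p\<rbrakk>
    \<Longrightarrow> g p (u + v) w = g p u w + g p v w"
  and metric_scale_left:
  "\<lbrakk>p \<in> points \<A>; u \<in> tangent_space \<A> p; v \<in> tangent_space \<A> p\<rbrakk>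
    \<Longrightarrow> g p (scale_vec a u) v = a * g p u v"
  and metric_pos:
  "\<lbrakk>p \<in> points \<A>; u \<in> tangent_space \<A> p; u \<noteq> 0\<rbrakk> \<Longrightarrow> g p u u > 0"
  using metric unfolding riemannian_metric_def by blast+

lemma inner_fields_sym: "\<lbrakk>X \<in> VF; Y \<in> VF\<rbrakk> \<Longrightarrow> inner_fields g X Y = inner_fields g Y X"
proof
  fix p assume "X \<in> VF" "Y \<in> VF"
  then show "inner_fields g X Y p = inner_fields g Y X p"
    using metric metric_sym VF_tangent
    by (cases "p \<in> points \<A>") (auto simp: inner_fields_def riemannian_metric_def)
qed

lemma inner_fields_add_left:
  "\<lbrakk>X \<in> VF; Y \<in> VF; Z \<in> VF\<rbrakk> \<Longrightarrow> inner_fields g (X + Y) Z = inner_fields g X Z + inner_fields g Y Z"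
proof
  fix p assume "X \<in> VF" "Y \<in> VF" "Z \<in> VF"
  then show "inner_fields g (X + Y) Z p = (inner_fields g X Z + inner_fields g Y Z) p"
    using metric metric_add_left VF_tangent
    by (cases "p \<in> points \<A>") (auto simp: inner_fields_def riemannian_metric_def)
qed

lemma inner_fields_diff_left:
  "\<lbrakk>X \<in> VF; Y \<in> VF; Z \<in> VF\<rbrakk> \<Longrightarrow> inner_fields g (X - Y) Z = inner_fields g X Z - inner_fields g Y Z"
  using inner_fields_add_left[of "X - Y" Y Z] VF_diff by (simp add: algebra_simps)

lemma inner_fields_zero_left: "W \<in> VF \<Longrightarrow> inner_fields g 0 W = 0"
  using inner_fields_diff_left[of W W W] by simp

lemma inner_fields_uminus_left:
  "\<lbrakk>X \<in> VF; Y \<in> VF\<rbrakk> \<Longrightarrow> inner_fields g (- X) Y = - inner_fields g X Y"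
  using inner_fields_diff_left[of X X Y] inner_fields_diff_left[of "X - X" X Y] VF_diff[of X X]
  by simp

lemma inner_fields_smooth: "\<lbrakk>X \<in> VF; Y \<in> VF\<rbrakk> \<Longrightarrow> inner_fields g X Y \<in> smooth_funs \<A>"
  using metric by (simp add: riemannian_metric_def)

lemma deriv_along_inner_fields:
  "\<lbrakk>X \<in> VF; Y \<in> VF; Z \<in> VF\<rbrakk> \<Longrightarrow>
    deriv_along X (inner_fields g Y Z) = inner_fields g (nabla X Y) Z + inner_fields g Y (nabla X Z)"
  using levi_civita by (simp add: levi_civita_def)

lemma deriv_along_add:
  "\<lbrakk>X \<in> VF; f \<in> smooth_funs \<A>; h \<in> smooth_funs \<A>\<rbrakk> \<Longrightarrow>
    deriv_along X (f + h) = deriv_along X f + deriv_along X h"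
  by (simp add: deriv_along_def fun_eq_iff VF_apply_add)

abbreviation "Rm \<equiv> riemann_tensor g nabla"

text \<open>
  This expands \<open>X (Y g(Z,W)) - Y (X g(Z,W)) - [X,Y] g(Z,W) = 0\<close> by metric compatibility.
\<close>

lemma riemann_tensor_skew_right:
  assumes X: "X \<in> VF" and Y: "Y \<in> VF" and Z: "Z \<in> VF" and W: "W \<in> VF"
  shows "Rm X Y W Z = - Rm X Y Z W"
proof -
  note mem = X Y Z W nabla_in_VF lie_bracket_in_VF VF_diff
  have second: "deriv_along X (deriv_along Y (inner_fields g Z W)) =
      inner_fields g (nabla X (nabla Y Z)) W + inner_fields g (nabla Y Z) (nabla X W)
      + (inner_fields g (nabla X Z) (nabla Y W) + inner_fields g Z (nabla X (nabla Y W)))"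
    if "X \<in> VF" "Y \<in> VF" for X Y
    using that by (simp add: deriv_along_inner_fields deriv_along_add inner_fields_smooth mem)
  have Rm: "Rm X Y Z W = inner_fields g (nabla X (nabla Y Z)) W - inner_fields g (nabla Y (nabla X Z)) W
      - inner_fields g (nabla (lie_bracket X Y) Z) W" if "Z \<in> VF" "W \<in> VF" for Z W
    using that by (simp add: riemann_tensor_def curvature_def inner_fields_diff_left mem)
  have "Rm X Y Z W + Rm X Y W Z = 0"
    using deriv_along_lie_bracket[of X Y "inner_fields g Z W"]
    unfolding second[OF X Y] second[OF Y X] Rm[OF Z W] Rm[OF W Z]
    by (simp add: deriv_along_inner_fields inner_fields_sym[of Z "nabla A B" for A B] mem algebra_simps)
  then show ?thesis
    by (simp add: add_eq_0_iff)
qed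

lemma riemann_tensor_skew_left:
  "\<lbrakk>X \<in> VF; Y \<in> VF; Z \<in> VF; W \<in> VF\<rbrakk> \<Longrightarrow> Rm Y X Z W = - Rm X Y Z W"
  by (simp add: riemann_tensor_def curvature_skew[of X Y] inner_fields_uminus_left curvature_in_VF)

lemma riemann_tensor_bianchi:
  assumes "X \<in> VF" "Y \<in> VF" "Z \<in> VF" "W \<in> VF"
  shows "Rm X Y Z W + Rm Y Z X W + Rm Z X Y W = 0"
proof -
  have "Rm X Y Z W + Rm Y Z X W + Rm Z X Y W
      = inner_fields g (curvature nabla X Y Z + curvature nabla Y Z X + curvature nabla Z X Y) W"
    using assms by (simp add: riemann_tensor_def inner_fields_add_left VF_add curvature_in_VF)
  also have "\<dots> = 0"
    unfolding first_bianchi[OF assms(1-3)]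
    using assms by (simp add: inner_fields_zero_left)
  finally show ?thesis .
qed

lemma riemann_tensor_add1:
  "\<lbrakk>X \<in> VF; X' \<in> VF; Y \<in> VF; Z \<in> VF; W \<in> VF\<rbrakk> \<Longrightarrow> Rm (X + X') Y Z W = Rm X Y Z W + Rm X' Y Z W"
  by (simp add: riemann_tensor_def curvature_add_left inner_fields_add_left curvature_in_VF)

lemma riemann_tensor_add3:
  "\<lbrakk>X \<in> VF; Y \<in> VF; Z \<in> VF; Z' \<in> VF; W \<in> VF\<rbrakk> \<Longrightarrow> Rm X Y (Z + Z') W = Rm X Y Z W + Rm X Y Z' W"
  by (simp add: riemann_tensor_def curvature_add_right inner_fields_add_left curvature_in_VF)

text \<open>
  A pointwise statement that does not need the tensoriality of the curvature in its first three
  arguments: the last argument enters through the metric at \<open>p\<close> only.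
\<close>

lemma riemann_tensor_proportional:
  assumes X: "X \<in> VF" and Y: "Y \<in> VF" and Z: "Z \<in> VF" and W: "W \<in> VF"
    and p: "p \<in> points \<A>" and WZ: "W p = scale_vec a (Z p)"
  shows "Rm X Y Z W p = 0"
proof -
  let ?C = "curvature nabla X Y Z"
  have C: "?C \<in> VF"
    using X Y Z by (rule curvature_in_VF)
  have "inner_fields g ?C W p = a * inner_fields g ?C Z p"
    using metric_scale_left[OF p VF_tangent[OF Z p] VF_tangent[OF C p], of a]
    by (simp add: inner_fields_sym[OF C] Z W) (simp add: inner_fields_def WZ)
  moreover have "Rm X Y Z Z p = 0"
    using fun_cong[OF riemann_tensor_skew_right[OF X Y Z Z], of p] by simp
  ultimately show ?thesis
    by (simp add: riemann_tensor_def)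
qed

lemma inner_fields_proportional:
  assumes X: "X \<in> VF" and Y: "Y \<in> VF" and p: "p \<in> points \<A>" and YX: "Y p = scale_vec a (X p)"
  shows "inner_fields g X X p * inner_fields g Y Y p - (inner_fields g X Y p)\<^sup>2 = 0"
proof -
  have lin: "inner_fields g Y Z p = a * inner_fields g X Z p" if "Z \<in> VF" for Z
    using metric_scale_left[OF p VF_tangent[OF X p] VF_tangent[OF that p], of a]
    by (simp add: inner_fields_def YX)
  show ?thesis
    unfolding lin[OF Y] inner_fields_sym[OF X Y] lin[OF X] by (simp add: power2_eq_square)
qed


section \<open>Constant sectional curvature\<close>

text \<open>
  For independent vectors the Gram determinant \<open>?d\<close> is nonzero: otherwise the quotient defining
  the sectional curvature is \<open>x / 0 = 0\<close>, whereas \<open>c \<noteq> 0\<close>. For dependent vectors both sides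
  vanish.
\<close>

lemma riemann_tensor_diagonal:
  assumes K: "constant_sectional_curvature \<A> g nabla c" "c \<noteq> 0"
    and X: "X \<in> VF" and Y: "Y \<in> VF" and p: "p \<in> points \<A>"
  shows "Rm X Y X Y p = c * (inner_fields g X X p * inner_fields g Y Y p - (inner_fields g X Y p)\<^sup>2)"
    (is "_ = c * ?d")
proof (cases "lin_indep2 (X p) (Y p)")
  case True
  then have "Rm X Y X Y p / ?d = c"
    using K X Y p by (simp add: constant_sectional_curvature_def sectional_curvature_def)
  with K(2) show ?thesis
    by (cases "?d = 0") (auto simp: field_simps)
next
  case False
  then obtain a b where ab: "scale_vec a (X p) + scale_vec b (Y p) = 0" "a \<noteq> 0 \<or> b \<noteq> 0"
    by (auto simp: lin_indep2_def)
  then have *: "a * X p f + b * Y p f = 0" for f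
    by (metis plus_fun_def scale_vec_def zero_fun_def)
  show ?thesis
  proof (cases "b = 0")
    case False
    with * have Yp: "Y p = scale_vec (- a / b) (X p)"
      by (auto simp: fun_eq_iff scale_vec_def field_simps eq_neg_iff_add_eq_0)
    show ?thesis
      using riemann_tensor_proportional[OF X Y X Y p Yp] inner_fields_proportional[OF X Y p Yp]
      by simp
  next
    case True
    with ab * have Xp: "X p = scale_vec 0 (Y p)"
      by (auto simp: fun_eq_iff scale_vec_def)
    show ?thesis
      using riemann_tensor_proportional[OF X Y Y X p Xp] inner_fields_proportional[OF Y X p Xp]
        riemann_tensor_skew_right[OF X Y Y X] inner_fields_sym[OF X Y]
      by (simp add: ac_simps)
  qed
qed

lemma constant_curvature_riemann_tensor:
  assumes K: "constant_sectional_curvature \<A> g nabla c" "c \<noteq> 0"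
    and "X \<in> VF" "Y \<in> VF" "Z \<in> VF" "W \<in> VF" and p: "p \<in> points \<A>"
  shows "Rm X Y Z W p = c * (inner_fields g X Z p * inner_fields g Y W p
    - inner_fields g X W p * inner_fields g Y Z p)"
proof -
  let ?i = "\<lambda>X Y. inner_fields g X Y p"
  let ?B = "\<lambda>X Y Z W. Rm X Y Z W p - c * (?i X Z * ?i Y W - ?i X W * ?i Y Z)"
  have sym: "?i X Y = ?i Y X" if "X \<in> VF" "Y \<in> VF" for X Y
    using inner_fields_sym that by metis
  have i_add: "?i (X + X') Y = ?i X Y + ?i X' Y" "?i Y (X + X') = ?i Y X + ?i Y X'"
    if "X \<in> VF" "X' \<in> VF" "Y \<in> VF" for X X' Y
    using that by (simp_all add: sym[of Y] inner_fields_add_left VF_add)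
  have "?B X Y Z W = 0"
  proof (rule curvature_like_form_zero[where V = VF and B = ?B])
    fix X Y Z W assume mem: "X \<in> VF" "Y \<in> VF" "Z \<in> VF" "W \<in> VF"
    show "?B Y X Z W = - ?B X Y Z W"
      using mem by (simp add: riemann_tensor_skew_left[of X Y] algebra_simps)
    show "?B X Y W Z = - ?B X Y Z W"
      using mem by (simp add: riemann_tensor_skew_right[of X Y Z W] algebra_simps)
    have "Rm X Y Z W p + Rm Y Z X W p + Rm Z X Y W p = 0"
      using fun_cong[OF riemann_tensor_bianchi[OF mem], of p] by simp
    then show "?B X Y Z W + ?B Y Z X W + ?B Z X Y W = 0"
      using mem by (simp add: sym[of Y X] sym[of Z X] sym[of Z Y] algebra_simps)
  next
    fix X Y assume mem: "X \<in> VF" "Y \<in> VF"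
    then show "?B X Y X Y = 0"
      using riemann_tensor_diagonal[OF K mem p] by (simp add: sym[of Y X] power2_eq_square)
  qed (use assms in \<open>simp_all add: VF_add riemann_tensor_add1 riemann_tensor_add3 i_add algebra_simps\<close>)
  then show ?thesis by simp
qed


section \<open>Almost-complex structures closed under the covariant exterior derivative\<close>

lemma orthogonal_field_exists:
  assumes dim: "DIM('e) \<ge> 3" and p: "p \<in> points \<A>" and X: "X \<in> VF" and Y: "Y \<in> VF"
  obtains W where "W \<in> VF" "W p \<noteq> 0" "inner_fields g W X p = 0" "inner_fields g W Y p = 0"
proof -
  obtain E :: "'e \<Rightarrow> 'a vfield" where E: "\<And>v. E v \<in> VF"
    and add: "\<And>v w. E (v + w) p = E v p + E w p"
    and scale: "\<And>a v. E (a *\<^sub>R v) p = scale_vec a (E v p)"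
    and nz: "\<And>v. v \<noteq> 0 \<Longrightarrow> E v p \<noteq> 0"
    using vector_field_frame[OF p] by blast
  \<comment> \<open>Each condition on \<open>E v\<close> is a linear equation in \<open>v\<close>; two of them have a nonzero
    solution, as the dimension is at least 3.\<close>
  have rep: "inner_fields g (E v) Z p = v \<bullet> adjoint (\<lambda>v. inner_fields g (E v) Z p) 1"
    if Z: "Z \<in> VF" for Z v
  proof -
    have "linear (\<lambda>v. inner_fields g (E v) Z p)"
      using E Z p
      by (intro linearI)
        (simp_all add: inner_fields_def add scale metric_add_left metric_scale_left VF_tangent)
    from adjoint_works[OF this, of v 1] show ?thesis by simp
  qed
  let ?S = "{adjoint (\<lambda>v. inner_fields g (E v) X p) 1, adjoint (\<lambda>v. inner_fields g (E v) Y p) 1}"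
  have "dim ?S \<le> card ?S"
    by (rule dim_le_card') simp
  also have "\<dots> \<le> 2"
    by (simp add: card_insert_if)
  finally have "dim ?S < DIM('e)"
    using dim by simp
  then obtain v where v: "v \<noteq> 0" "\<And>y. y \<in> span ?S \<Longrightarrow> orthogonal v y"
    using orthogonal_to_subspace_exists by metis
  have "orthogonal v y" if "y \<in> ?S" for y
    using v(2) span_base[OF that] by blast
  then show thesis
    using that[of "E v"] E nz v(1) rep[OF X, of v] rep[OF Y, of v] by (auto simp: orthogonal_def)
qed

text \<open>
  For \<open>W\<close> orthogonal to \<open>U\<close> and \<open>A U\<close>, one of the three terms of the cyclic identity, paired with
  \<open>W\<close>, vanishes, and the two others contribute with the same sign because \<open>A (A U) = - U\<close>.
\<close>

lemma almost_complex_not_d_nabla_closed: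
  assumes dim: "DIM('e) \<ge> 3" and K: "constant_sectional_curvature \<A> g nabla c" "c \<noteq> 0"
    and A: "A \<in> almost_complex_structures \<A>"
    and closed: "\<And>X Y. \<lbrakk>X \<in> VF; Y \<in> VF\<rbrakk> \<Longrightarrow> d_nabla nabla A X Y = 0"
  shows False
proof -
  let ?F = "apply_endo A"
  let ?i = "inner_fields g"
  have F: "?F X \<in> VF" if "X \<in> VF" for X
    using A that by (simp add: almost_complex_structures_def tangent_one_forms_def)
  have F_add: "?F (X + Y) = ?F X + ?F Y" if "X \<in> VF" "Y \<in> VF" for X Y
  proof
    fix p show "?F (X + Y) p = (?F X + ?F Y) p"
      using A that VF_tangent
      by (cases "p \<in> points \<A>")
        (auto simp: apply_endo_def almost_complex_structures_def tangent_one_forms_def)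
  qed
  have F_square: "?F (?F X) = - X" if "X \<in> VF" for X
  proof
    fix p show "?F (?F X) p = (- X) p"
    proof (cases "p \<in> points \<A>")
      case True
      then have "A p (A p (X p)) = - X p"
        using A VF_tangent[OF that] by (simp add: almost_complex_structures_def)
      then show ?thesis
        by (simp add: apply_endo_def)
    next
      case False
      then have "A p u = 0" "X p = 0" for u
        using A that
        by (simp_all add: almost_complex_structures_def tangent_one_forms_def vector_fields_def)
      then show ?thesis
        by (simp add: apply_endo_def)
    qed
  qed
  have F_diff: "?F (X - Y) = ?F X - ?F Y" if "X \<in> VF" "Y \<in> VF" for X Y
    using F_add[of "X - Y" Y] that VF_diff by (simp add: algebra_simps)
  have exchange: "nabla X (?F Y) - nabla Y (?F X) = ?F (lie_bracket X Y)"
    if "X \<in> VF" "Y \<in> VF" for X Y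
    using closed[OF that] that
    by (simp add: d_nabla_def cov_deriv_endo_def lie_bracket_eq F_diff nabla_in_VF algebra_simps)
  obtain p where p: "p \<in> points \<A>"
    using smooth_manifold unfolding points_eq_topspace smooth_manifold_def by blast
  obtain U where U: "U \<in> VF" "U p \<noteq> 0"
    using vector_field_frame[OF p] nonzero_Basis[OF SOME_Basis] by metis
  obtain W where W: "W \<in> VF" "W p \<noteq> 0" "?i W U p = 0" "?i W (?F U) p = 0"
    using orthogonal_field_exists[OF dim p U(1) F[OF U(1)]] by blast
  note mem = U(1) W(1) F
  \<comment> \<open>The cyclic identity for \<open>W\<close>, \<open>U\<close> and \<open>A U\<close>, paired with \<open>W\<close>.\<close>
  have "curvature nabla W U (- U) + curvature nabla U (?F U) (?F W) + curvature nabla (?F U) W (?F U) = 0"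
    using curvature_cyclic_sum[OF F F_add exchange W(1) U(1) F[OF U(1)]] by (simp add: F_square U(1))
  then have "?i (curvature nabla W U (- U) + curvature nabla U (?F U) (?F W)
      + curvature nabla (?F U) W (?F U)) W p = ?i 0 W p"
    by simp
  then have "Rm W U (- U) W p + Rm U (?F U) (?F W) W p + Rm (?F U) W (?F U) W p = 0"
    using mem by (simp add: riemann_tensor_def inner_fields_add_left inner_fields_zero_left VF_add
        VF_uminus curvature_in_VF)
  moreover have "?i U W p = 0" "?i (?F U) W p = 0" "?i U (- U) p = - ?i U U p"
    using W(3,4) mem inner_fields_sym[of W] inner_fields_sym[of U "- U"]
    by (auto simp: VF_uminus inner_fields_uminus_left)
  ultimately have "c * (?i W W p * (?i U U p + ?i (?F U) (?F U) p)) = 0"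
    using mem p by (simp add: constant_curvature_riemann_tensor[OF K] VF_uminus algebra_simps)
  moreover have "?i W W p > 0" "?i U U p > 0"
    using U W p metric_pos VF_tangent by (auto simp: inner_fields_def)
  moreover have "?F U p \<noteq> 0"
  proof
    assume "?F U p = 0"
    then have "?F (?F U) p = ?F (U - U) p"
      by (simp add: apply_endo_def)
    then show False
      using U F_diff[of U U] by (simp add: F_square)
  qed
  then have "?i (?F U) (?F U) p > 0"
    using F[OF U(1)] p metric_pos VF_tangent by (auto simp: inner_fields_def)
  ultimately show False
    using K(2) by simp
qed

end

theorem theorem1:
  fixes T :: "'a topology"
    and \<A> :: "('a, 'e::euclidean_space) atlas"
    and g :: "'a metric_tensor"
    and nabla :: "'a conn"
    and c\<^sub>0 :: real
  assumes "smooth_manifold T \<A>"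
    and "DIM('e) \<ge> 4"
    and "riemannian_metric \<A> g"
    and "levi_civita \<A> g nabla"
    and "constant_sectional_curvature \<A> g nabla c\<^sub>0"
    and "c\<^sub>0 \<noteq> 0"
  shows "\<not> (\<exists>A\<in>complex_structures \<A>.
            \<forall>X\<in>vector_fields \<A>. \<forall>Y\<in>vector_fields \<A>. d_nabla nabla A X Y = 0)"
proof
  interpret levi_civita_mfd T \<A> g nabla
    by unfold_locales (use assms in auto)
  assume "\<exists>A\<in>complex_structures \<A>. \<forall>X\<in>VF. \<forall>Y\<in>VF. d_nabla nabla A X Y = 0"
  then obtain A where "A \<in> almost_complex_structures \<A>"
    and "\<And>X Y. \<lbrakk>X \<in> VF; Y \<in> VF\<rbrakk> \<Longrightarrow> d_nabla nabla A X Y = 0"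
    unfolding complex_structures_def by blast
  moreover have "DIM('e) \<ge> 3"
    using assms(2) by simp
  ultimately show False
    by (intro almost_complex_not_d_nabla_closed[OF _ assms(5,6)])
qed

end
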